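(* Let $I\subseteq\mathbb{R}$ be an interval, let $f,g:I\to[0,\infty)$ be Nesbitt-convex functions, and let $a,b\in I$ with $a<b$. Then $$\frac{1}{b-a}\int_a^b f(x)g(x)\,dx\le\left(\frac{125}{6}-\frac{147}{8}\ln 3\right)\bigl(f(a)g(a)+f(b)g(b)\bigr)+\left(\frac{117}{8}\ln 3-\frac{95}{6}\right)\bigl(f(a)g(b)+f(b)g(a)\bigr).$$
   Context: Definition (Nesbitt-convex function). Let $I\subseteq\mathbb{R}$ be a nonempty interval. A function $f:I\to[0,\infty)$ is called Nesbitt-convex if $$f(tx+(1-t)y)\le\left(\frac{2t^2}{3-2t}+\frac{2t(1-t)}{1+2t}\right)f(x)+\left(\frac{2t(1-t)}{3-2t}+\frac{2(1-t)^2}{1+2t}\right)f(y)$$ for all $x,y\in I$ and all $t\in(0,1]$. *)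

theory Defs
  imports "HOL-Analysis.Analysis"
begin

text \<open>As with \<^const>\<open>convex_on\<close>, the conditions on the domain and the codomain
  \<open>[0, \<infinity>)\<close> are part of the predicate; values outside \<open>I\<close> are irrelevant.\<close>

definition nesbitt_convex_on :: "real set \<Rightarrow> (real \<Rightarrow> real) \<Rightarrow> bool" where
  "nesbitt_convex_on I f \<longleftrightarrow>
     is_interval I \<and> I \<noteq> {} \<and> (\<forall>x\<in>I. 0 \<le> f x) \<and>
     (\<forall>x\<in>I. \<forall>y\<in>I. \<forall>t\<in>{0<..1}.
        f (t * x + (1 - t) * y)
          \<le> (2 * t\<^sup>2 / (3 - 2 * t) + 2 * t * (1 - t) / (1 + 2 * t)) * f x
            + (2 * t * (1 - t) / (3 - 2 * t) + 2 * (1 - t)\<^sup>2 / (1 + 2 * t)) * f y)"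

end

theory Submission imports Defs begin

text \<open>At \<open>t = 1/2\<close> both Nesbitt weights equal \<open>1/2\<close>, and they are bounded by \<open>2\<close> on \<open>[0, 1]\<close>;
  so a Nesbitt-convex function is midpoint convex and bounded on compact intervals, hence convex in
  the usual sense. The classical Hermite--Hadamard estimate for a product, with constants
  \<open>1/3\<close> and \<open>1/6\<close>, therefore applies, and these constants are smaller than the stated ones.\<close>

text \<open>This passes from midpoint convexity to convexity: \<open>h\<close> will be a function
  minus its chord, and an upper bound takes the place of continuity.\<close>

lemma midpoint_convex_bounded_above_imp_nonpos:
  fixes h :: "real \<Rightarrow> real"
  assumes mid: "\<And>s t. s \<in> {0..1} \<Longrightarrow> t \<in> {0..1} \<Longrightarrow> h ((s + t) / 2) \<le> (h s + h t) / 2"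
    and ends: "h 0 \<le> 0" "h 1 \<le> 0"
    and bound: "\<And>t. t \<in> {0..1} \<Longrightarrow> h t \<le> K"
    and t: "t \<in> {0..1}"
  shows "h t \<le> 0"
proof -
  \<comment> \<open>Every point of \<open>[0, 1]\<close> is the midpoint of an endpoint and another point of \<open>[0, 1]\<close>,
    so any upper bound may be halved.\<close>
  have halve: "h t \<le> L / 2" if L: "\<And>t. t \<in> {0..1} \<Longrightarrow> h t \<le> L" and t: "t \<in> {0..1}" for L t
  proof (cases "t \<le> 1 / 2")
    case True
    then show ?thesis
      using mid[of 0 "2 * t"] L[of "2 * t"] ends t by auto
  next
    case False
    then show ?thesis
      using mid[of 1 "2 * t - 1"] L[of "2 * t - 1"] ends t by auto
  qed
  have iter: "h t \<le> K / 2 ^ n" if "t \<in> {0..1}" for n t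
    using that
  proof (induction n arbitrary: t)
    case 0
    then show ?case using bound by simp
  next
    case (Suc n)
    then show ?case using halve[of "K / 2 ^ n" t] by (simp add: field_simps)
  qed
  have "(\<lambda>n. K / 2 ^ n) \<longlonglongrightarrow> 0"
    by (rule LIMSEQ_divide_realpow_zero) simp
  then show ?thesis
    using iter[OF t] by (intro LIMSEQ_le_const) auto
qed

lemma nesbitt_convex_on_imp_convex_on:
  assumes f: "nesbitt_convex_on I f"
  shows "convex_on I f"
proof -
  have I: "convex I" and nonneg: "\<And>x. x \<in> I \<Longrightarrow> 0 \<le> f x"
    using f by (auto simp: nesbitt_convex_on_def is_interval_convex)
  have nesbitt: "f (t * x + (1 - t) * y)
      \<le> (2 * t\<^sup>2 / (3 - 2 * t) + 2 * t * (1 - t) / (1 + 2 * t)) * f x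
        + (2 * t * (1 - t) / (3 - 2 * t) + 2 * (1 - t)\<^sup>2 / (1 + 2 * t)) * f y"
    if "x \<in> I" "y \<in> I" "0 < t" "t \<le> 1" for x y t
    using f that by (auto simp: nesbitt_convex_on_def)
  have mid: "f ((x + y) / 2) \<le> (f x + f y) / 2" if "x \<in> I" "y \<in> I" for x y
    using nesbitt[OF that, of "1 / 2"] by (simp add: power2_eq_square field_simps)
  have bound: "f (t * x + (1 - t) * y) \<le> 4 * (f x + f y)"
    if "x \<in> I" "y \<in> I" "0 \<le> t" "t \<le> 1" for x y t
  \<comment> \<open>The Nesbitt inequality covers only positive \<open>t\<close>; at
    \<open>t = 0\<close> the left side is \<open>f y\<close> and the bound follows from
    nonnegativity.\<close>
  proof (cases "t = 0")
    case True
    then show ?thesis using nonneg that by auto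
  next
    case False
    have sq: "t\<^sup>2 \<le> 1" "(1 - t)\<^sup>2 \<le> 1" "t * (1 - t) \<le> 1"
      using that by (auto intro: power_le_one mult_le_one)
    \<comment> \<open>On the unit interval both denominators are at least 1 and all numerators at
      most 2. Each weight is a sum of two such fractions, hence the factor 4.\<close>
    have "2 * t\<^sup>2 / (3 - 2 * t) \<le> 2" "2 * t * (1 - t) / (1 + 2 * t) \<le> 2"
      "2 * t * (1 - t) / (3 - 2 * t) \<le> 2" "2 * (1 - t)\<^sup>2 / (1 + 2 * t) \<le> 2"
      using that sq by (auto simp: pos_divide_le_eq)
    then have "(2 * t\<^sup>2 / (3 - 2 * t) + 2 * t * (1 - t) / (1 + 2 * t)) * f x
        + (2 * t * (1 - t) / (3 - 2 * t) + 2 * (1 - t)\<^sup>2 / (1 + 2 * t)) * f y \<le> 4 * f x + 4 * f y"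
      using nonneg that by (intro add_mono mult_right_mono) auto
    then show ?thesis
      using nesbitt[of x y t] that False by simp
  qed
  show ?thesis
  proof (rule convex_onI[OF _ I])
    fix t x y :: real
    assume t: "0 < t" "t < 1" and x: "x \<in> I" and y: "y \<in> I"
    \<comment> \<open>Subtracting the chord, which is affine in \<open>s\<close>, keeps midpoint
      convexity and makes \<open>h\<close> vanish at 0 and 1; convexity of \<open>f\<close> at
      \<open>t\<close> is then \<open>h t \<le> 0\<close>.\<close>
    define h where "h s = f (s * y + (1 - s) * x) - (s * f y + (1 - s) * f x)" for s
    have mem: "s * y + (1 - s) * x \<in> I" if "s \<in> {0..1}" for s
      using convexD[OF I y x, of s "1 - s"] that by simp
    have "h t \<le> 0"
    proof (rule midpoint_convex_bounded_above_imp_nonpos[where h = h])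
      fix r s :: real
      assume "r \<in> {0..1}" "s \<in> {0..1}"
      then have "f (((r * y + (1 - r) * x) + (s * y + (1 - s) * x)) / 2)
          \<le> (f (r * y + (1 - r) * x) + f (s * y + (1 - s) * x)) / 2"
        by (rule mid[OF mem mem])
      moreover have "((r * y + (1 - r) * x) + (s * y + (1 - s) * x)) / 2
          = (r + s) / 2 * y + (1 - (r + s) / 2) * x"
        by (simp add: field_simps)
      ultimately have "f ((r + s) / 2 * y + (1 - (r + s) / 2) * x)
          \<le> (f (r * y + (1 - r) * x) + f (s * y + (1 - s) * x)) / 2"
        by (simp only:)
      then show "h ((r + s) / 2) \<le> (h r + h s) / 2"
        unfolding h_def by (simp add: field_simps)
    next
      fix s :: real
      assume s: "s \<in> {0..1}"
      \<comment> \<open>As the chord is nonnegative, an upper bound for \<open>f\<close> on the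
        segment also bounds \<open>h\<close>.\<close>
      then have "0 \<le> s * f y + (1 - s) * f x"
        using nonneg x y by simp
      with bound[OF y x, of s] s show "h s \<le> 4 * (f y + f x)"
        unfolding h_def by simp
    qed (use t in \<open>auto simp: h_def\<close>)
    then show "f ((1 - t) *\<^sub>R x + t *\<^sub>R y) \<le> (1 - t) * f x + t * f y"
      by (simp add: h_def algebra_simps)
  qed
qed

lemma convex_on_Icc_chord:
  fixes f :: "real \<Rightarrow> real"
  assumes "convex_on {a..b} f" "a < b" "x \<in> {a..b}"
  shows "f x \<le> ((b - x) * f a + (x - a) * f b) / (b - a)"
proof -
  define u where "u = (x - a) / (b - a)"
  have u: "0 \<le> u" "u \<le> 1" "u * (b - a) = x - a"
    using assms(2,3) by (auto simp: u_def)
  have diff: "1 - u = (b - x) / (b - a)"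
    using \<open>a < b\<close> by (simp add: u_def divide_simps)
  have "(1 - u) *\<^sub>R a + u *\<^sub>R b = x"
    using u(3) by (simp add: algebra_simps)
  moreover have "f ((1 - u) *\<^sub>R a + u *\<^sub>R b) \<le> (1 - u) * f a + u * f b"
    using assms u by (intro convex_onD) auto
  moreover have "(1 - u) * f a + u * f b = ((b - x) * f a + (x - a) * f b) / (b - a)"
    unfolding diff by (simp add: u_def add_divide_distrib)
  ultimately show ?thesis by simp
qed

text \<open>By nonnegativity, the chord bounds for \<open>f\<close> and \<open>g\<close> can be
  multiplied. The product of the chords is a quadratic polynomial that dominates
  \<open>f x * g x\<close> and has an explicit integral.\<close>

lemma convex_nonneg_on_Icc_mult:
  fixes f g :: "real \<Rightarrow> real"
  assumes f: "convex_on {a..b} f" "\<And>x. x \<in> {a..b} \<Longrightarrow> 0 \<le> f x"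
    and g: "convex_on {a..b} g" "\<And>x. x \<in> {a..b} \<Longrightarrow> 0 \<le> g x"
    and ab: "a < b"
  shows convex_nonneg_on_Icc_mult_integrable: "(\<lambda>x. f x * g x) integrable_on {a..b}"
    and convex_nonneg_on_Icc_mult_integral_le: "integral {a..b} (\<lambda>x. f x * g x)
      \<le> (b - a) * ((f a * g a + f b * g b) / 3 + (f a * g b + f b * g a) / 6)"
proof -
  define A B C where "A = f a * g a" and "B = f b * g b" and "C = f a * g b + f b * g a"
  \<comment> \<open>\<open>p\<close> is the product of the two chords, and \<open>P\<close> is an
    antiderivative of it; the mixed term is integrated via (b - x)(x - a) = (b - a)(x - a) - (x -
    a)^2.\<close>
  define p where "p x = ((b - x)\<^sup>2 * A + (x - a)\<^sup>2 * B + (b - x) * (x - a) * C) / (b - a)\<^sup>2" for x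
  define P where "P x = ((x - a) ^ 3 / 3 * B - (b - x) ^ 3 / 3 * A
    + ((b - a) * (x - a)\<^sup>2 / 2 - (x - a) ^ 3 / 3) * C) / (b - a)\<^sup>2" for x
  have le: "f x * g x \<le> p x" if x: "x \<in> {a..b}" for x
  proof -
    have "f x * g x \<le> (((b - x) * f a + (x - a) * f b) / (b - a)) *
        (((b - x) * g a + (x - a) * g b) / (b - a))"
      using convex_on_Icc_chord[OF f(1) ab x] convex_on_Icc_chord[OF g(1) ab x] f(2) g(2) x ab
      by (intro mult_mono) (auto intro!: divide_nonneg_pos add_nonneg_nonneg mult_nonneg_nonneg)
    also have "\<dots> = p x"
      unfolding p_def A_def B_def C_def times_divide_times_eq
      by (simp add: power2_eq_square algebra_simps)
    finally show ?thesis .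
  qed
  have "(p has_integral (P b - P a)) {a..b}"
  proof (rule fundamental_theorem_of_calculus)
    fix x
    have "(P has_real_derivative p x) (at x within {a..b})"
      unfolding P_def p_def
      by (rule DERIV_cdivide) (auto intro!: derivative_eq_intros simp: power2_eq_square field_simps)
    then show "(P has_vector_derivative p x) (at x within {a..b})"
      by (simp add: has_real_derivative_iff_has_vector_derivative)
  qed (use ab in simp)
  moreover have "P b - P a = (b - a) * ((A + B) / 3 + C / 6)"
  proof -
    define d where "d = b - a"
    then have "d \<noteq> 0" "b = a + d"
      using ab by auto
    then show ?thesis
      by (simp add: P_def power2_eq_square power3_eq_cube field_simps)
  qed
  ultimately have p: "(p has_integral (b - a) * ((A + B) / 3 + C / 6)) {a..b}"
    by simp
  \<comment> \<open>A convex function may jump at the endpoints but is continuous in between. So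
    integrability is shown on the open interval, with \<open>p\<close> as dominating function, and
    carried over to the closed one.\<close>
  have cont: "continuous_on {a<..<b} (\<lambda>x. f x * g x)"
    using f(1) g(1)
    by (intro continuous_on_mult convex_on_continuous) (auto intro: convex_on_subset)
  have "(\<lambda>x. f x * g x) integrable_on {a<..<b}"
  proof (rule measurable_bounded_by_integrable_imp_integrable)
    show "(\<lambda>x. f x * g x) \<in> borel_measurable (lebesgue_on {a<..<b})"
      using cont by (intro continuous_imp_measurable_on_sets_lebesgue) auto
    show "p integrable_on {a<..<b}"
      using p by (auto simp flip: integrable_on_Icc_iff_Ioo)
  qed (use le f(2) g(2) in auto)
  then show int: "(\<lambda>x. f x * g x) integrable_on {a..b}"
    by (simp add: integrable_on_Icc_iff_Ioo)
  show "integral {a..b} (\<lambda>x. f x * g x)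
      \<le> (b - a) * ((f a * g a + f b * g b) / 3 + (f a * g b + f b * g a) / 6)"
    using has_integral_le[OF integrable_integral[OF int] p] le
    by (simp add: A_def B_def C_def)
qed

text \<open>The two fractions are the thresholds at which 117/8 ln 3 - 95/6 equals 1/6 and 125/6 -
  147/8 ln 3 equals 1/3. Four terms of the logarithm series suffice.\<close>

lemma ln_3_bounds: "128 / 117 \<le> ln (3 :: real)" "ln (3 :: real) \<le> 164 / 147"
  using ln_approx_bounds[of 3 4] by (auto simp: lessThan_nat_numeral eval_nat_numeral)

theorem theorem7:
  fixes I :: "real set" and f g :: "real \<Rightarrow> real" and a b :: real
  assumes "is_interval I"
    and "nesbitt_convex_on I f" and "nesbitt_convex_on I g"
    and "a \<in> I" and "b \<in> I" and "a < b"
  shows "(\<lambda>x. f x * g x) integrable_on {a..b} \<and>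
    1 / (b - a) * integral {a..b} (\<lambda>x. f x * g x)
      \<le> (125 / 6 - 147 / 8 * ln 3) * (f a * g a + f b * g b)
        + (117 / 8 * ln 3 - 95 / 6) * (f a * g b + f b * g a)"
proof
  have sub: "{a..b} \<subseteq> I"
    using assms by (meson atLeastAtMost_iff mem_is_interval_1_I subsetI)
  have nonneg: "0 \<le> f x" "0 \<le> g x" if "x \<in> {a..b}" for x
    using assms(2,3) sub that by (auto simp: nesbitt_convex_on_def)
  have conv: "convex_on {a..b} f" "convex_on {a..b} g"
    using assms(2,3) sub
    by (auto intro: convex_on_subset[OF nesbitt_convex_on_imp_convex_on])
  note mult = conv(1) nonneg(1) conv(2) nonneg(2) \<open>a < b\<close>
  \<comment> \<open>Since \<open>integral\<close> defaults to 0 for non-integrable functions,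
    integrability is established separately to give the estimate its intended meaning.\<close>
  show "(\<lambda>x. f x * g x) integrable_on {a..b}"
    by (rule convex_nonneg_on_Icc_mult_integrable[OF mult])
  have "1 / (b - a) * integral {a..b} (\<lambda>x. f x * g x)
      \<le> 1 / 3 * (f a * g a + f b * g b) + 1 / 6 * (f a * g b + f b * g a)"
    using convex_nonneg_on_Icc_mult_integral_le[OF mult] \<open>a < b\<close> by (simp add: field_simps)
  \<comment> \<open>The constants are compared one by one, which is sound because both sums of
    products of endpoint values are nonnegative.\<close>
  also have "\<dots> \<le> (125 / 6 - 147 / 8 * ln 3) * (f a * g a + f b * g b)
        + (117 / 8 * ln 3 - 95 / 6) * (f a * g b + f b * g a)"
    using ln_3_bounds nonneg[of a] nonneg[of b] \<open>a < b\<close>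
    by (intro add_mono mult_right_mono) auto
  finally show "1 / (b - a) * integral {a..b} (\<lambda>x. f x * g x)
      \<le> (125 / 6 - 147 / 8 * ln 3) * (f a * g a + f b * g b)
        + (117 / 8 * ln 3 - 95 / 6) * (f a * g b + f b * g a)" .
qed

end
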